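(* Let $n$ be a positive integer. Then each of $$\frac{1-q}{1-q^{6n-1}}\begin{bmatrix}12n\\3n\end{bmatrix}_q,\ \frac{1-q}{1-q^{6n-1}}\begin{bmatrix}12n\\4n\end{bmatrix}_q,\ \frac{1-q}{1-q^{30n-1}}\begin{bmatrix}60n\\6n\end{bmatrix}_q,\ \frac{1-q}{1-q^{30n-1}}\begin{bmatrix}120n\\40n\end{bmatrix}_q,\ \frac{1-q}{1-q^{30n-1}}\begin{bmatrix}120n\\45n\end{bmatrix}_q,\ \frac{1-q}{1-q^{66n-1}}\begin{bmatrix}330n\\88n\end{bmatrix}_q$$ is a polynomial in $q$ with non-negative integer coefficients. Furthermore, $$\frac{(1-q)^2}{(1-q^{10n-1})(1-q^{15n-1})}\begin{bmatrix}30n\\5n\end{bmatrix}_q$$ is a polynomial in $q$.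
   Context: The $q$-binomial coefficient is defined by $\begin{bmatrix}n\\k\end{bmatrix}_q=\frac{(1-q^n)(1-q^{n-1})\cdots(1-q)}{(1-q^k)\cdots(1-q)\,(1-q^{n-k})\cdots(1-q)}$ for $0\le k\le n$, and $0$ otherwise. *)

theory Defs
  imports "HOL-Computational_Algebra.Computational_Algebra"
begin

text \<open>
  Rational functions in \<open>q\<close> are elements of the fraction field of \<open>\<int>[q]\<close>; it coincides
  with \<open>\<rat>(q)\<close>.
\<close>

type_synonym qfun = "int poly fract"

definition q :: qfun where
  "q = to_fract [:0, 1:]"

definition qbinomial :: "nat \<Rightarrow> nat \<Rightarrow> qfun" where
  "qbinomial n k =
     (if k \<le> n
      then (\<Prod>i=1..n. 1 - q ^ i) / ((\<Prod>i=1..k. 1 - q ^ i) * (\<Prod>i=1..n - k. 1 - q ^ i))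
      else 0)"

text \<open>
  Coefficients are taken in \<open>\<int>\<close>. For quotients whose denominators are products of
  \<open>1 - q ^ m\<close> (monic up to sign) this agrees with membership in \<open>\<rat>[q]\<close>.
\<close>

definition is_polynomial :: "qfun \<Rightarrow> bool" where
  "is_polynomial f \<longleftrightarrow> (\<exists>p. f = to_fract p)"

definition is_nonneg_polynomial :: "qfun \<Rightarrow> bool" where
  "is_nonneg_polynomial f \<longleftrightarrow> (\<exists>p. f = to_fract p \<and> (\<forall>i. coeff p i \<ge> 0))"

end

theory Submission
  imports Defs
begin

text \<open>
  Polynomiality is checked root by root. If \<open>z\<close> is a primitive \<open>d\<close>-th root of unity, then
  \<open>(1 - q) \<cdots> (1 - q ^ n)\<close> vanishes at \<open>z\<close> to order \<open>n div d\<close>, hence the \<open>q\<close>-binomial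
  coefficient vanishes at \<open>z\<close> as soon as \<open>n mod d < k mod d\<close>. This holds for every divisor
  \<open>d > 1\<close> of the exponent in the denominator. The quotient has integer coefficients because
  the denominator has leading coefficient \<open>\<plusminus> 1\<close>.

  Positivity rests on unimodality. Up to a power of \<open>q\<close>, the \<open>q\<close>-binomial coefficient is the
  generating function of the sums of the \<open>k\<close>-subsets of \<open>{0..n-1}\<close>, that is, the character of
  an exterior power of an \<open>sl\<^sub>2\<close>-module. With respect to an orthonormal weight basis, raising
  and lowering operators are adjoint, so the commutator relation gives
  \<open>|E v|\<^sup>2 = |F v|\<^sup>2 + c |v|\<^sup>2\<close> with \<open>c > 0\<close> below the middle weight and \<open>c < 0\<close> above it. Thus
  \<open>E\<close>, respectively \<open>F\<close>, is injective there and the coefficients rise up to the middle and fall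
  afterwards. If \<open>(1 - q ^ m) r = (1 - q) g\<close> with such a \<open>g\<close>, then comparing coefficients from
  the bottom up to the middle, and from the top down to the middle, shows that \<open>r\<close> is
  non-negative.
\<close>

section \<open>The products of \<open>1 - q ^ i\<close> and their leading coefficients\<close>

definition qfact :: "nat \<Rightarrow> 'a::comm_ring_1 poly" where
  "qfact n = (\<Prod>i=1..n. 1 - monom 1 i)"

lemma qfact_0 [simp]: "qfact 0 = 1"
  by (simp add: qfact_def)

lemma qfact_Suc: "qfact (Suc n) = qfact n * (1 - monom 1 (Suc n))"
  by (simp add: qfact_def)

lemma one_minus_monom_nonzero: "i > 0 \<Longrightarrow> 1 - monom 1 i \<noteq> (0 :: 'a::comm_ring_1 poly)"
  by (simp add: monom_eq_1_iff)

lemma qfact_nonzero: "qfact n \<noteq> (0 :: 'a::idom poly)"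
  by (simp add: qfact_def monom_eq_1_iff)

lemma degree_one_minus_monom:
  "degree (1 - monom 1 i :: 'a::comm_ring_1 poly) = i"
  if "i > 0"
proof -
  have "degree (- monom 1 i + 1 :: 'a poly) = i"
    using that by (subst degree_add_eq_left) (auto simp: degree_monom_eq)
  then show ?thesis by simp
qed

lemma lead_coeff_one_minus_monom:
  "i > 0 \<Longrightarrow> lead_coeff (1 - monom 1 i :: 'a::comm_ring_1 poly) = -1"
  by (simp add: degree_one_minus_monom)

lemma unit_lead_coeff_qfact: "lead_coeff (qfact n :: int poly) dvd 1"
proof (induction n)
  case (Suc n)
  have "lead_coeff (qfact (Suc n) :: int poly) = lead_coeff (qfact n) * - 1"
    unfolding qfact_Suc lead_coeff_mult by (subst lead_coeff_one_minus_monom) simp_all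
  with Suc show ?case by simp
qed simp

section \<open>Divisibility of products of \<open>1 - q ^ i\<close>\<close>

text \<open>Away from 0 the derivative does not vanish, so every root is simple.\<close>

lemma order_one_minus_monom:
  fixes z :: complex
  assumes "i > 0"
  shows "order z (1 - monom 1 i) = of_bool (z ^ i = 1)"
proof (cases "z ^ i = 1")
  case True
  let ?p = "1 - monom 1 i :: complex poly"
  have "z \<noteq> 0" using True assms by (auto simp: power_0_left)
  then have "poly (pderiv ?p) z \<noteq> 0"
    using assms by (simp add: pderiv_diff pderiv_monom poly_monom)
  then have "order z (pderiv ?p) = 0" by (rule order_0I)
  with True show ?thesis
    using order_pderiv[of ?p z] one_minus_monom_nonzero[OF assms, where 'a = complex]
    by (simp add: poly_monom)
next
  case False
  then show ?thesis by (simp add: order_0I poly_monom)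
qed

text \<open>If \<open>z\<close> is not a root of unity, then \<open>d = 0\<close>.\<close>

lemma power_eq_1_iff_dvd:
  fixes z :: "'a::field"
  obtains d :: nat where "\<And>i. z ^ i = 1 \<longleftrightarrow> d dvd i"
proof (cases "\<exists>i>0. z ^ i = 1")
  case False
  have "z ^ i = 1 \<longleftrightarrow> 0 dvd i" for i using False by (metis dvd_0_left_iff gr0I power_0)
  then show ?thesis by (rule that)
next
  case True
  define d where "d = (LEAST i. i > 0 \<and> z ^ i = 1)"
  have d: "d > 0" "z ^ d = 1"
    using LeastI_ex[OF True] by (simp_all add: d_def)
  have "z ^ i = 1 \<longleftrightarrow> d dvd i" for i
  proof -
    have "z ^ i = (z ^ d) ^ (i div d) * z ^ (i mod d)"
      by (simp flip: power_mult power_add)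
    then have eq: "z ^ i = z ^ (i mod d)" by (simp add: d)
    have "i mod d = 0" if "z ^ (i mod d) = 1"
    proof (rule ccontr)
      assume "i mod d \<noteq> 0"
      with that have "d \<le> i mod d" unfolding d_def by (intro Least_le) auto
      with d mod_less_divisor[of d i] show False by linarith
    qed
    with eq show ?thesis by (metis mod_eq_0_iff_dvd power_0)
  qed
  then show ?thesis by (rule that)
qed

text \<open>Exactly \<open>n div d\<close> of the factors have an exponent divisible by
  \<open>d\<close>, and each contributes a simple zero. The value \<open>d = 0\<close> fits because
  \<open>n div 0 = 0\<close>.\<close>

lemma order_qfact:
  fixes z :: complex
  assumes "\<And>i. z ^ i = 1 \<longleftrightarrow> d dvd i"
  shows "order z (qfact n) = n div d"
proof (induction n)
  case (Suc n)
  have "order z (qfact (Suc n)) = n div d + of_bool (d dvd Suc n)"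
    unfolding qfact_Suc
    by (subst order_mult)
      (simp_all add: Suc qfact_nonzero monom_eq_1_iff order_one_minus_monom assms
        del: power_Suc)
  also have "\<dots> = Suc n div d"
    by (simp add: div_Suc dvd_eq_mod_eq_0)
  finally show ?case .
qed simp

lemma order_prod:
  assumes "finite A" "\<And>x. x \<in> A \<Longrightarrow> f x \<noteq> 0"
  shows "order z (\<Prod>x\<in>A. f x) = (\<Sum>x\<in>A. order z (f x :: 'a::idom poly))"
  using assms by (induction A rule: finite_induct) (simp_all add: order_mult)

text \<open>Splitting off a common root lowers both orders there by one; over an algebraically
  closed field this continues until \<open>p\<close> is constant.\<close>

lemma dvd_if_order_le:
  fixes p p' :: "'a::alg_closed_field poly"
  assumes "p \<noteq> 0" "p' \<noteq> 0" "\<And>z. order z p \<le> order z p'"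
  shows "p dvd p'"
  using assms
proof (induction "degree p" arbitrary: p p' rule: less_induct)
  case less
  show ?case
  proof (cases "degree p = 0")
    case True
    with less.prems show ?thesis by (metis degree_0_id is_unit_iff_degree unit_imp_dvd)
  next
    case False
    then obtain z where z: "poly p z = 0"
      using alg_closed_imp_poly_has_root[of p] by auto
    with less.prems have "poly p' z = 0"
      by (metis le_zero_eq order_root)
    with z obtain r r' where r: "p = [:-z, 1:] * r" "p' = [:-z, 1:] * r'"
      by (auto simp: poly_eq_0_iff_dvd elim!: dvdE)
    with less.prems have nz: "r \<noteq> 0" "r' \<noteq> 0" by auto
    have "order w r \<le> order w r'" for w
      using less.prems(3)[of w] less.prems(1,2) unfolding r
      by (simp add: order_mult del: mult_pCons_left)
    moreover have "degree r < degree p"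
      using nz unfolding r by (subst degree_mult_eq) auto
    ultimately have "r dvd r'" using nz less.hyps by blast
    then show ?thesis unfolding r by (rule mult_dvd_mono[OF dvd_refl])
  qed
qed

section \<open>Descent of divisibility from complex to integer polynomials\<close>

abbreviation cpoly :: "int poly \<Rightarrow> complex poly" where
  "cpoly \<equiv> map_poly of_int"

lemma cpoly_mult: "cpoly (p * r) = cpoly p * cpoly r"
  by (rule poly_eqI) (simp add: coeff_map_poly coeff_mult)

lemma cpoly_add: "cpoly (p + r) = cpoly p + cpoly r"
  by (rule poly_eqI) (simp add: coeff_map_poly)

lemma cpoly_one_minus_monom: "cpoly (1 - monom 1 i) = 1 - monom 1 i"
  by (rule poly_eqI) (simp add: coeff_map_poly)

lemma cpoly_prod: "cpoly (\<Prod>x\<in>A. f x) = (\<Prod>x\<in>A. cpoly (f x))"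
  by (induction A rule: infinite_finite_induct) (simp_all add: cpoly_mult)

lemma cpoly_qfact: "cpoly (qfact n) = qfact n"
  by (simp add: qfact_def cpoly_prod cpoly_one_minus_monom)

lemma degree_cpoly: "degree (cpoly p) = degree p"
  by (rule degree_map_poly) simp

text \<open>Pseudo-division leaves an integer remainder that is zero or of smaller degree than
  \<open>p\<close>. Over the complex numbers \<open>p\<close> divides it, so it is zero. The
  multiplier is a power of the leading coefficient, hence a unit.\<close>

lemma dvd_if_cpoly_dvd:
  assumes "cpoly p dvd cpoly p'" and unit: "lead_coeff p dvd 1"
  shows "p dvd p'"
proof -
  have "p \<noteq> 0" using unit by (metis coeff_0 not_is_unit_0)
  obtain s r where sr: "pseudo_divmod p' p = (s, r)" by fastforce
  define c where "c = lead_coeff p ^ (Suc (degree p') - degree p)"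
  have c: "c dvd 1" unfolding c_def using unit by (rule is_unit_power_iff[THEN iffD2, OF disjI1])
  have eq: "smult c p' = p * s + r" and deg: "r = 0 \<or> degree r < degree p"
    using pseudo_divmod[OF \<open>p \<noteq> 0\<close> sr] by (simp_all add: c_def)
  have "cpoly p * cpoly s + cpoly r = smult (of_int c) (cpoly p')"
    unfolding cpoly_mult[symmetric] cpoly_add[symmetric] eq[symmetric]
    by (simp add: map_poly_smult)
  with assms(1) have "cpoly p dvd cpoly r"
    by (metis dvd_add_right_iff dvd_smult dvd_triv_left)
  have "r = 0"
  proof (rule ccontr)
    assume "r \<noteq> 0"
    then have "cpoly r \<noteq> 0" by (simp add: map_poly_eq_0_iff)
    with \<open>cpoly p dvd cpoly r\<close> have "degree p \<le> degree r"
      using dvd_imp_degree_le degree_cpoly by metis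
    with deg \<open>r \<noteq> 0\<close> show False by auto
  qed
  with eq have "p dvd smult c p'" by simp
  with c show ?thesis
    by (metis dvdE dvd_smult smult_1_left smult_smult mult.commute)
qed

text \<open>The extra term is the carry in adding \<open>k\<close> and \<open>n - k\<close> modulo
  \<open>d\<close>: if the residue of the sum falls below that of \<open>k\<close>, the two residues
  add up to at least \<open>d\<close>. For \<open>d = 0\<close> it vanishes because
  \<open>k \<le> n\<close>.\<close>

lemma div_add_le_div:
  fixes d k n :: nat
  assumes "k \<le> n"
  shows "k div d + (n - k) div d + of_bool (n mod d < k mod d) \<le> n div d"
proof (cases "d = 0")
  case False
  have "n = k + (n - k)" using assms by simp
  then have "n div d = k div d + (n - k) div d + (k mod d + (n - k) mod d) div d"
    by (metis div_add1_eq)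
  moreover have "d \<le> k mod d + (n - k) mod d" if "n mod d < k mod d"
  proof (rule ccontr)
    assume "\<not> ?thesis"
    then have "(k + (n - k)) mod d = k mod d + (n - k) mod d"
      by (subst mod_add_eq[symmetric]) (simp add: not_le)
    with that assms show False by simp
  qed
  then have "of_bool (n mod d < k mod d) \<le> (k mod d + (n - k) mod d) div d"
    using False by (auto simp: Suc_le_eq div_greater_zero_iff)
  ultimately show ?thesis by simp
qed (use assms in simp)

text \<open>Orders of vanishing are compared at each complex \<open>z\<close>. The carry hypothesis
  supplies the extra zero that a factor \<open>1 - monom 1 m\<close> demands at a root of unity of
  order \<open>d > 1\<close>.\<close>

lemma qfact_dvd:
  fixes M :: "nat set"
  assumes "finite M" "0 \<notin> M" "k \<le> n"
    and coprime: "\<And>m m'. m \<in> M \<Longrightarrow> m' \<in> M \<Longrightarrow> m \<noteq> m' \<Longrightarrow> coprime m m'"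
    and carry: "\<And>m d. m \<in> M \<Longrightarrow> d dvd m \<Longrightarrow> d > 1 \<Longrightarrow> n mod d < k mod d"
  shows "(\<Prod>m\<in>M. 1 - monom 1 m) * (qfact k * qfact (n - k)) dvd
    (\<Prod>m\<in>M. 1 - monom 1 1) * (qfact n :: int poly)"
    (is "?p dvd ?p'")
proof (rule dvd_if_cpoly_dvd)
  have pos: "m > 0" if "m \<in> M" for m using that assms(2) by (cases m) auto
  have "lead_coeff (\<Prod>m\<in>M. 1 - monom 1 m :: int poly) = (\<Prod>m\<in>M. -1)"
    unfolding lead_coeff_prod using pos by (intro prod.cong lead_coeff_one_minus_monom) auto
  also have "\<dots> dvd 1" by simp
  finally show "lead_coeff ?p dvd 1"
    using unit_lead_coeff_qfact[of k] unit_lead_coeff_qfact[of "n - k"]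
    by (simp only: lead_coeff_mult) (simp only: is_unit_mult_iff)
  have nz: "(\<Prod>m\<in>M. 1 - monom 1 m :: complex poly) \<noteq> 0"
    using pos \<open>finite M\<close> by (force simp: monom_eq_1_iff)
  have nz1: "(\<Prod>m\<in>M. 1 - monom 1 1 :: complex poly) \<noteq> 0"
    using \<open>finite M\<close> by (simp add: monom_eq_1_iff)
  have p: "cpoly ?p = (\<Prod>m\<in>M. 1 - monom 1 m) * (qfact k * qfact (n - k))"
    and p': "cpoly ?p' = (\<Prod>m\<in>M. 1 - monom 1 1) * qfact n"
    by (simp_all only: cpoly_mult cpoly_prod cpoly_qfact cpoly_one_minus_monom)
  show "cpoly ?p dvd cpoly ?p'"
    unfolding p p'
  proof (rule dvd_if_order_le)
    fix z :: complex
    obtain d where d: "\<And>i. z ^ i = 1 \<longleftrightarrow> d dvd i"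
      by (rule power_eq_1_iff_dvd[of z]) blast
    have "order z (\<Prod>m\<in>M. 1 - monom 1 m) = (\<Sum>m\<in>M. order z (1 - monom 1 m))"
      using \<open>finite M\<close> pos by (intro order_prod) (force simp: monom_eq_1_iff)+
    also have "\<dots> = (\<Sum>m\<in>M. of_bool (d dvd m))"
      using pos by (intro sum.cong) (auto simp: order_one_minus_monom d)
    finally have 1: "order z (\<Prod>m\<in>M. 1 - monom 1 m) = (\<Sum>m\<in>M. of_bool (d dvd m))" .
    have "order z (\<Prod>m\<in>M. 1 - monom 1 1) = (\<Sum>m\<in>M. order z (1 - monom 1 1))"
      using \<open>finite M\<close> by (intro order_prod) (auto simp: monom_eq_1_iff)
    also have "\<dots> = (\<Sum>m\<in>M. of_bool (d dvd 1))"
      by (simp only: order_one_minus_monom d zero_less_one)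
    finally have 2: "order z (\<Prod>m\<in>M. 1 - monom 1 1) = (\<Sum>m\<in>M. of_bool (d dvd 1))" .
    have "(\<Sum>m\<in>M. of_bool (d dvd m)) \<le>
        (\<Sum>m\<in>M. of_bool (d dvd 1)) + (of_bool (n mod d < k mod d) :: nat)"
    \<comment> \<open>In the first case coprimality leaves exactly one \<open>m\<close> divisible by
      \<open>d\<close>, and one carry pays for it. Otherwise no \<open>m\<close> is divisible by
      \<open>d\<close>, or \<open>d = 1\<close> and the factors \<open>1 - monom 1 1\<close>
      pay.\<close>
    proof (cases "d \<noteq> 1 \<and> (\<exists>m\<in>M. d dvd m)")
      case True
      then obtain m where m: "m \<in> M" "d dvd m" "d > 1"
        using pos by (metis dvd_0_left_iff less_one linorder_neqE_nat less_irrefl)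
      have "of_bool (d dvd m') = (0::nat)" if "m' \<in> M - {m}" for m'
        using that coprime[of m m'] m by (auto dest: coprime_common_divisor)
      then have "(\<Sum>m\<in>M. of_bool (d dvd m)) = (1 :: nat)"
        using m \<open>finite M\<close> by (subst sum.remove[of _ m]) auto
      with carry[OF m] show ?thesis by simp
    next
      case False
      then have "(\<Sum>m\<in>M. of_bool (d dvd m)) \<le> (\<Sum>m\<in>M. of_bool (d dvd 1) :: nat)"
        by (intro sum_mono) auto
      then show ?thesis by simp
    qed
    with div_add_le_div[OF \<open>k \<le> n\<close>, of d]
    show "order z ((\<Prod>m\<in>M. 1 - monom 1 m) * (qfact k * qfact (n - k))) \<le>
      order z ((\<Prod>m\<in>M. 1 - monom 1 1) * qfact n)"
      using nz nz1 by (simp add: order_mult qfact_nonzero 1 2 order_qfact[OF d]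
        del: One_nat_def prod_constant sum_constant)
  qed (use nz nz1 in \<open>auto simp: qfact_nonzero simp del: One_nat_def\<close>)
qed

section \<open>Unimodality of subset sums\<close>

text \<open>Gaussian elimination, one equation at a time. It turns a comparison of cardinalities
  into a nonzero kernel vector.\<close>

lemma underdetermined_system:
  fixes c :: "'b \<Rightarrow> 'a \<Rightarrow> 'f::field"
  assumes "finite B" "finite A" "card B < card A"
  shows "\<exists>v. (\<exists>a\<in>A. v a \<noteq> 0) \<and> (\<forall>a. a \<notin> A \<longrightarrow> v a = 0) \<and>
    (\<forall>b\<in>B. (\<Sum>a\<in>A. c b a * v a) = 0)"
  using assms
proof (induction B arbitrary: A c rule: finite_induct)
  case empty
  then have "A \<noteq> {}" by auto
  then obtain a where "a \<in> A" by blast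
  then show ?case by (intro exI[of _ "\<lambda>x. of_bool (x = a)"]) auto
next
  case (insert b B)
  show ?case
  proof (cases "\<forall>a\<in>A. c b a = 0")
    case True
    have "card B < card A" using insert by simp
    from insert.IH[OF insert.prems(1) this, of c] obtain v where
      v: "\<exists>a\<in>A. v a \<noteq> 0" "\<forall>a. a \<notin> A \<longrightarrow> v a = 0" "\<forall>b\<in>B. (\<Sum>a\<in>A. c b a * v a) = 0"
      by blast
    moreover have "(\<Sum>a\<in>A. c b a * v a) = 0" using True by (intro sum.neutral) auto
    ultimately show ?thesis by blast
  next
    case False
    then obtain p where p: "p \<in> A" "c b p \<noteq> 0" by blast
    define A' where "A' = A - {p}"
    have A': "finite A'" "card B < card A'" "p \<notin> A'" "A = insert p A'"
      using insert p by (auto simp: A'_def)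
    \<comment> \<open>The rows after subtracting the multiple of row \<open>b\<close> that clears
      the pivot column \<open>p\<close>.\<close>
    define c' where "c' = (\<lambda>b' a. c b' a - c b' p * c b a / c b p)"
    from insert.IH[OF A'(1,2), of c'] obtain u
      where u: "\<exists>a\<in>A'. u a \<noteq> 0" "\<forall>a. a \<notin> A' \<longrightarrow> u a = 0"
        "\<And>b'. b' \<in> B \<Longrightarrow> (\<Sum>a\<in>A'. c' b' a * u a) = 0"
      by metis
    \<comment> \<open>Back substitution: this value of the pivot unknown solves equation
      \<open>b\<close>.\<close>
    define t where "t = - (\<Sum>a\<in>A'. c b a * u a) / c b p"
    define v where "v = u(p := t)"
    have split: "(\<Sum>a\<in>A. c b' a * v a) = c b' p * t + (\<Sum>a\<in>A'. c b' a * u a)" for b'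
    proof -
      have "(\<Sum>a\<in>A'. c b' a * v a) = (\<Sum>a\<in>A'. c b' a * u a)"
        using A' by (intro sum.cong) (auto simp: v_def)
      then show ?thesis using A' by (simp add: v_def)
    qed
    have "(\<Sum>a\<in>A. c b' a * v a) = 0" if "b' \<in> B" for b'
    proof -
      have "0 = (\<Sum>a\<in>A'. c b' a * u a - c b' p / c b p * (c b a * u a))"
        using u(3)[OF that] by (simp add: c'_def algebra_simps)
      also have "\<dots> = (\<Sum>a\<in>A'. c b' a * u a) + c b' p * t"
        by (simp add: sum_subtractf t_def sum_distrib_left sum_divide_distrib)
      finally show ?thesis by (simp add: split add.commute)
    qed
    moreover have "(\<Sum>a\<in>A. c b a * v a) = 0"
      using p by (simp add: split t_def)
    moreover have "\<exists>a\<in>A. v a \<noteq> 0" "\<forall>a. a \<notin> A \<longrightarrow> v a = 0"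
      using u(1,2) A'(3,4) unfolding v_def by (metis fun_upd_apply insertCI)+
    ultimately show ?thesis by blast
  qed
qed

section \<open>Single-step moves on sets and the ladder operators built from them\<close>

definition up :: "nat \<Rightarrow> nat set \<Rightarrow> nat set" where
  "up i S = insert (Suc i) (S - {i})"

definition down :: "nat \<Rightarrow> nat set \<Rightarrow> nat set" where
  "down i S = insert i (S - {Suc i})"

abbreviation can_up :: "nat \<Rightarrow> nat set \<Rightarrow> bool" where
  "can_up i S \<equiv> i \<in> S \<and> Suc i \<notin> S"

abbreviation can_down :: "nat \<Rightarrow> nat set \<Rightarrow> bool" where
  "can_down i S \<equiv> Suc i \<in> S \<and> i \<notin> S"

lemma down_up: "can_up i S \<Longrightarrow> down i (up i S) = S"
  and up_down: "can_down i S \<Longrightarrow> up i (down i S) = S"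
  by (auto simp: up_def down_def)

lemma can_up_down: "can_down i S \<Longrightarrow> can_up i (down i S)"
  by (auto simp: down_def)

lemma up_subset: "i < n \<Longrightarrow> S \<subseteq> {..<Suc n} \<Longrightarrow> up i S \<subseteq> {..<Suc n}"
  and down_subset: "i < n \<Longrightarrow> S \<subseteq> {..<Suc n} \<Longrightarrow> down i S \<subseteq> {..<Suc n}"
  by (auto simp: up_def down_def)

lemma card_sum_up:
  assumes "finite S" "can_up i S"
  shows "card (up i S) = card S" "\<Sum>(up i S) = Suc (\<Sum>S)"
proof -
  have S: "S = insert i (S - {i})" using assms by auto
  have "\<Sum>S = i + \<Sum>(S - {i})" using assms by (subst S, subst sum.insert) auto
  with assms show "\<Sum>(up i S) = Suc (\<Sum>S)"
    unfolding up_def by (subst sum.insert) auto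
  show "card (up i S) = card S"
    using assms card_Suc_Diff1[of S i] by (simp add: up_def)
qed

text \<open>The exterior power of the irreducible \<open>sl\<^sub>2\<close>-module of dimension \<open>n + 1\<close>, in an
  orthonormal weight basis indexed by sets \<open>S \<subseteq> {0..n}\<close>, so that the raising and lowering
  operators are adjoint to each other.\<close>

definition ladder_coeff :: "nat \<Rightarrow> nat \<Rightarrow> real" where
  "ladder_coeff n i = sqrt ((real i + 1) * (real n - real i))"

text \<open>Acts on coefficient functions: the value at \<open>T\<close> collects the sets that
  reach \<open>T\<close> by one upward move. No exterior-power signs occur, because a move to a free
  neighbouring position keeps the elements in order.\<close>

definition raise_op :: "nat \<Rightarrow> (nat set \<Rightarrow> real) \<Rightarrow> nat set \<Rightarrow> real" where
  "raise_op n v T = (\<Sum>i<n. ladder_coeff n i * (if can_down i T then v (down i T) else 0))"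

definition lower_op :: "nat \<Rightarrow> (nat set \<Rightarrow> real) \<Rightarrow> nat set \<Rightarrow> real" where
  "lower_op n v T = (\<Sum>i<n. ladder_coeff n i * (if can_up i T then v (up i T) else 0))"

text \<open>With \<open>T' = down i (down j T)\<close>, the sets \<open>up j T'\<close> and
  \<open>up i T'\<close> are \<open>down i T\<close> and \<open>down j T\<close>, so the mixed terms
  match bijectively and cancel in the commutator.\<close>

lemma raise_cross_eq_lower_cross:
  fixes v :: "nat set \<Rightarrow> real"
  assumes "i < n" "j < n" "i \<noteq> j"
  shows "(\<Sum>T\<in>Pow {..<Suc n}. (if can_down i T then v (down i T) else 0) *
      (if can_down j T then v (down j T) else 0)) =
    (\<Sum>T\<in>Pow {..<Suc n}. (if can_up i T then v (up i T) else 0) *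
      (if can_up j T then v (up j T) else 0))" (is "?L = ?R")
proof -
  have "?L = (\<Sum>T\<in>{T \<in> Pow {..<Suc n}. can_down i T \<and> can_down j T}. v (down i T) * v (down j T))"
    by (rule sum.mono_neutral_cong_right) auto
  also have "\<dots> = (\<Sum>T\<in>{T \<in> Pow {..<Suc n}. can_up i T \<and> can_up j T}. v (up i T) * v (up j T))"
  proof (rule sum.reindex_bij_witness[of _ "\<lambda>T. up i (up j T)" "\<lambda>T. down i (down j T)"])
    fix T assume T: "T \<in> {T \<in> Pow {..<Suc n}. can_down i T \<and> can_down j T}"
    \<comment> \<open>Adjacent moves exclude each other: \<open>Suc i = j\<close> would put
      \<open>j\<close> both inside and outside \<open>T\<close>.\<close>
    then have ne: "Suc i \<noteq> j" "Suc j \<noteq> i" by auto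
    show "up i (up j (down i (down j T))) = T"
      using T ne assms by (auto simp: up_def down_def)
    show "down i (down j T) \<in> {T \<in> Pow {..<Suc n}. can_up i T \<and> can_up j T}"
      using T ne assms by (auto simp: up_def down_def)
    have "up i (down i (down j T)) = down j T"  "up j (down i (down j T)) = down i T"
      using T ne assms by (auto simp: up_def down_def)
    then show "v (up i (down i (down j T))) * v (up j (down i (down j T))) =
        v (down i T) * v (down j T)" by simp
  next
    fix T assume T: "T \<in> {T \<in> Pow {..<Suc n}. can_up i T \<and> can_up j T}"
    then have ne: "Suc i \<noteq> j" "Suc j \<noteq> i" by auto
    show "down i (down j (up i (up j T))) = T"
      using T ne assms by (auto simp: up_def down_def)
    show "up i (up j T) \<in> {T \<in> Pow {..<Suc n}. can_down i T \<and> can_down j T}"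
      using T ne assms by (auto simp: up_def down_def)
  qed
  also have "\<dots> = ?R"
    by (rule sum.mono_neutral_cong_left) auto
  finally show ?thesis .
qed

lemma raise_diag:
  fixes v :: "nat set \<Rightarrow> real"
  assumes "i < n"
  shows "(\<Sum>T\<in>Pow {..<Suc n}. (if can_down i T then v (down i T) else 0)\<^sup>2) =
    (\<Sum>S\<in>Pow {..<Suc n}. of_bool (can_up i S) * (v S)\<^sup>2)" (is "?L = ?R")
proof -
  have "?L = (\<Sum>T\<in>{T \<in> Pow {..<Suc n}. can_down i T}. (v (down i T))\<^sup>2)"
    by (rule sum.mono_neutral_cong_right) auto
  also have "\<dots> = (\<Sum>S\<in>{S \<in> Pow {..<Suc n}. can_up i S}. (v S)\<^sup>2)"
    by (rule sum.reindex_bij_witness[of _ "up i" "down i"])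
      (use assms in \<open>auto simp: up_def down_def\<close>)
  also have "\<dots> = ?R"
    by (rule sum.mono_neutral_cong_left) auto
  finally show ?thesis .
qed

lemma lower_diag:
  fixes v :: "nat set \<Rightarrow> real"
  assumes "i < n"
  shows "(\<Sum>T\<in>Pow {..<Suc n}. (if can_up i T then v (up i T) else 0)\<^sup>2) =
    (\<Sum>S\<in>Pow {..<Suc n}. of_bool (can_down i S) * (v S)\<^sup>2)" (is "?L = ?R")
proof -
  have "?L = (\<Sum>T\<in>{T \<in> Pow {..<Suc n}. can_up i T}. (v (up i T))\<^sup>2)"
    by (rule sum.mono_neutral_cong_right) auto
  also have "\<dots> = (\<Sum>S\<in>{S \<in> Pow {..<Suc n}. can_down i S}. (v S)\<^sup>2)"
    by (rule sum.reindex_bij_witness[of _ "down i" "up i"])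
      (use assms in \<open>auto simp: up_def down_def\<close>)
  also have "\<dots> = ?R"
    by (rule sum.mono_neutral_cong_left) auto
  finally show ?thesis .
qed

text \<open>The right-hand side is the weight of the basis vector \<open>S\<close>. The difference
  of indicators is \<open>chi i - chi (Suc i)\<close>, so summation by parts applies, and
  \<open>a i - b i = n - 2 * i\<close>.\<close>

lemma weight_eq:
  assumes "S \<subseteq> {..<Suc n}"
  shows "(\<Sum>i<n. (ladder_coeff n i)\<^sup>2 * (of_bool (can_up i S) - of_bool (can_down i S))) =
    real n * card S - 2 * real (\<Sum>S)"
proof -
  define chi :: "nat \<Rightarrow> real" where "chi i = of_bool (i \<in> S)" for i
  define a where "a i = (real i + 1) * (real n - real i)" for i
  define b where "b i = real i * (real n - real i + 1)" for i
  have "(\<Sum>i<n. (ladder_coeff n i)\<^sup>2 * (of_bool (can_up i S) - of_bool (can_down i S))) =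
      (\<Sum>i<n. a i * chi i - b (Suc i) * chi (Suc i))"
    by (rule sum.cong) (auto simp: ladder_coeff_def chi_def a_def b_def)
  \<comment> \<open>The boundary terms are zero: \<open>a n = 0\<close> and
    \<open>b 0 = 0\<close>.\<close>
  also have "\<dots> = (\<Sum>i<Suc n. a i * chi i) - (\<Sum>i<Suc n. b i * chi i)"
    unfolding sum_subtractf sum.lessThan_Suc[of "\<lambda>i. a i * chi i"]
      sum.lessThan_Suc_shift[of "\<lambda>i. b i * chi i"]
    by (simp add: a_def b_def)
  also have "\<dots> = (\<Sum>i<Suc n. (real n - 2 * real i) * chi i)"
    unfolding sum_subtractf[symmetric] by (rule sum.cong) (auto simp: a_def b_def algebra_simps)
  also have "\<dots> = (\<Sum>i\<in>S. real n - 2 * real i)"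
    by (rule sum.mono_neutral_cong_right) (use assms in \<open>auto simp: chi_def\<close>)
  also have "\<dots> = real n * card S - 2 * real (\<Sum>S)"
    by (simp add: sum_subtractf sum_distrib_left sum_distrib_right mult.commute)
  finally show ?thesis .
qed

text \<open>The commutator relation of \<open>sl\<^sub>2\<close>, as an identity of quadratic forms.\<close>

lemma raise_lower_norm:
  fixes v :: "nat set \<Rightarrow> real"
  shows "(\<Sum>T\<in>Pow {..<Suc n}. (raise_op n v T)\<^sup>2) = (\<Sum>T\<in>Pow {..<Suc n}. (lower_op n v T)\<^sup>2) +
    (\<Sum>S\<in>Pow {..<Suc n}. (real n * card S - 2 * real (\<Sum>S)) * (v S)\<^sup>2)"
proof -
  let ?P = "Pow {..<Suc n}"
  define r where "r = ladder_coeff n"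
  define U where "U i T = (if can_down i T then v (down i T) else 0)" for i T
  define D where "D i T = (if can_up i T then v (up i T) else 0)" for i T
  define E where "E i = (\<Sum>S\<in>?P. of_bool (can_up i S) * (v S)\<^sup>2) -
    (\<Sum>S\<in>?P. of_bool (can_down i S) * (v S)\<^sup>2)" for i
  have expand: "(\<Sum>T\<in>?P. (\<Sum>i<n. r i * F i T)\<^sup>2) =
      (\<Sum>i<n. \<Sum>j<n. r i * r j * (\<Sum>T\<in>?P. F i T * F j T))" for F :: "nat \<Rightarrow> nat set \<Rightarrow> real"
  proof -
    have "(\<Sum>T\<in>?P. (\<Sum>i<n. r i * F i T)\<^sup>2) =
        (\<Sum>T\<in>?P. \<Sum>i<n. \<Sum>j<n. r i * r j * (F i T * F j T))"
      by (simp add: power2_eq_square sum_product algebra_simps)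
    also have "\<dots> = (\<Sum>i<n. \<Sum>T\<in>?P. \<Sum>j<n. r i * r j * (F i T * F j T))"
      by (rule sum.swap)
    also have "\<dots> = (\<Sum>i<n. \<Sum>j<n. \<Sum>T\<in>?P. r i * r j * (F i T * F j T))"
      by (intro sum.cong refl sum.swap)
    finally show ?thesis by (simp only: sum_distrib_left)
  qed
  \<comment> \<open>The two forms differ only on the diagonal; the defects \<open>E i\<close> are
    regrouped by \<open>S\<close> below, where each \<open>S\<close> contributes its weight.\<close>
  have "(\<Sum>T\<in>?P. U i T * U j T) = (\<Sum>T\<in>?P. D i T * D j T) + (if j = i then E i else 0)"
    if "i < n" "j < n" for i j
  proof (cases "i = j")
    case True
    show ?thesis
      using raise_diag[OF that(1), of v] lower_diag[OF that(1), of v]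
      unfolding True[symmetric] U_def D_def E_def power2_eq_square by simp
  next
    case False
    with raise_cross_eq_lower_cross[OF that False, of v] show ?thesis
      by (simp add: U_def D_def)
  qed
  then have "(\<Sum>i<n. \<Sum>j<n. r i * r j * (\<Sum>T\<in>?P. U i T * U j T)) =
      (\<Sum>i<n. \<Sum>j<n. r i * r j * (\<Sum>T\<in>?P. D i T * D j T) + (if j = i then r i * r j * E i else 0))"
    by (intro sum.cong refl) (auto simp: distrib_left)
  also have "\<dots> = (\<Sum>i<n. \<Sum>j<n. r i * r j * (\<Sum>T\<in>?P. D i T * D j T)) + (\<Sum>i<n. (r i)\<^sup>2 * E i)"
    by (simp add: sum.distrib power2_eq_square)
  also have "(\<Sum>i<n. (r i)\<^sup>2 * E i) =
      (\<Sum>i<n. \<Sum>S\<in>?P. (r i)\<^sup>2 * (of_bool (can_up i S) - of_bool (can_down i S)) * (v S)\<^sup>2)"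
    unfolding E_def sum_subtractf[symmetric] sum_distrib_left
    by (intro sum.cong refl) (simp add: algebra_simps)
  also have "\<dots> = (\<Sum>S\<in>?P. \<Sum>i<n. (r i)\<^sup>2 * (of_bool (can_up i S) - of_bool (can_down i S)) * (v S)\<^sup>2)"
    by (rule sum.swap)
  also have "\<dots> = (\<Sum>S\<in>?P. (real n * card S - 2 * real (\<Sum>S)) * (v S)\<^sup>2)"
    unfolding sum_distrib_right[symmetric] r_def
    by (intro sum.cong refl arg_cong2[where f = "(*)"] weight_eq) auto
  finally show ?thesis
    unfolding expand[symmetric] by (simp add: raise_op_def lower_op_def r_def U_def D_def)
qed

section \<open>Weight layers: \<open>k\<close>-subsets with a prescribed sum\<close>

definition subsets_of_sum :: "nat \<Rightarrow> nat \<Rightarrow> nat \<Rightarrow> nat set set" where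
  "subsets_of_sum n k w = {S. S \<subseteq> {..<n} \<and> card S = k \<and> \<Sum>S = w}"

lemma finite_subsets_of_sum: "finite (subsets_of_sum n k w)"
  by (rule finite_subset[of _ "Pow {..<n}"]) (auto simp: subsets_of_sum_def)

lemma subsets_of_sum_up:
  assumes "i < n" "can_up i S"
  shows "S \<in> subsets_of_sum (Suc n) k w \<longleftrightarrow> up i S \<in> subsets_of_sum (Suc n) k (Suc w)"
proof (cases "S \<subseteq> {..<Suc n}")
  case True
  then have "finite S" by (rule finite_subset) simp
  with True show ?thesis
    using card_sum_up[of S i] up_subset[OF assms(1) True] assms by (auto simp: subsets_of_sum_def)
next
  case False
  moreover have "\<not> up i S \<subseteq> {..<Suc n}"
  proof
    assume "up i S \<subseteq> {..<Suc n}"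
    from down_subset[OF assms(1) this] False show False by (simp add: down_up[OF assms(2)])
  qed
  ultimately show ?thesis by (simp add: subsets_of_sum_def)
qed

lemma subsets_of_sum_down:
  assumes "i < n" "can_down i S"
  shows "S \<in> subsets_of_sum (Suc n) k (Suc w) \<longleftrightarrow> down i S \<in> subsets_of_sum (Suc n) k w"
  using subsets_of_sum_up[OF assms(1) can_up_down[OF assms(2)], of k w]
  by (simp add: up_down[OF assms(2)])

lemma weighted_norm:
  assumes "\<And>S. S \<notin> subsets_of_sum (Suc n) k w \<Longrightarrow> v S = (0 :: real)"
  shows "(\<Sum>S\<in>Pow {..<Suc n}. (real n * card S - 2 * real (\<Sum>S)) * (v S)\<^sup>2) =
    (real n * k - 2 * real w) * (\<Sum>S\<in>subsets_of_sum (Suc n) k w. (v S)\<^sup>2)"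
  unfolding sum_distrib_left
  by (rule sum.mono_neutral_cong_right) (auto simp: subsets_of_sum_def assms simp del: of_nat_sum)

lemma supported_sum_squares_pos:
  fixes v :: "'a \<Rightarrow> real"
  assumes "finite A" "\<exists>a\<in>A. v a \<noteq> 0"
  shows "(\<Sum>a\<in>A. (v a)\<^sup>2) > 0"
  using assms by (auto intro: sum_pos2)

text \<open>Presents the operator as an explicit matrix, the form in which
  \<open>underdetermined_system\<close> yields kernel vectors.\<close>

lemma raise_op_eq_sum:
  fixes v :: "nat set \<Rightarrow> real"
  assumes v: "\<And>S. S \<notin> subsets_of_sum (Suc n) k w \<Longrightarrow> v S = 0"
  shows "raise_op n v T = (\<Sum>S\<in>subsets_of_sum (Suc n) k w.
      (\<Sum>i<n. ladder_coeff n i * of_bool (can_down i T \<and> down i T = S)) * v S)"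
proof -
  let ?A = "subsets_of_sum (Suc n) k w"
  have "(if can_down i T then v (down i T) else 0) =
      (\<Sum>S\<in>?A. of_bool (can_down i T \<and> down i T = S) * v S)" for i
  proof -
    have "(\<Sum>S\<in>?A. of_bool (can_down i T \<and> down i T = S) * v S) =
        (\<Sum>S\<in>?A. if S = down i T then of_bool (can_down i T) * v S else 0)"
      by (intro sum.cong refl) auto
    also have "\<dots> = (if can_down i T then v (down i T) else 0)"
      using v by (simp add: finite_subsets_of_sum)
    finally show ?thesis ..
  qed
  then show ?thesis
    unfolding raise_op_def sum_distrib_right
    by (subst sum.swap) (simp only: sum_distrib_left mult.assoc)
qed

lemma lower_op_eq_sum:
  fixes v :: "nat set \<Rightarrow> real"
  assumes v: "\<And>S. S \<notin> subsets_of_sum (Suc n) k w \<Longrightarrow> v S = 0"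
  shows "lower_op n v T = (\<Sum>S\<in>subsets_of_sum (Suc n) k w.
      (\<Sum>i<n. ladder_coeff n i * of_bool (can_up i T \<and> up i T = S)) * v S)"
proof -
  let ?A = "subsets_of_sum (Suc n) k w"
  have "(if can_up i T then v (up i T) else 0) =
      (\<Sum>S\<in>?A. of_bool (can_up i T \<and> up i T = S) * v S)" for i
  proof -
    have "(\<Sum>S\<in>?A. of_bool (can_up i T \<and> up i T = S) * v S) =
        (\<Sum>S\<in>?A. if S = up i T then of_bool (can_up i T) * v S else 0)"
      by (intro sum.cong refl) auto
    also have "\<dots> = (if can_up i T then v (up i T) else 0)"
      using v by (simp add: finite_subsets_of_sum)
    finally show ?thesis ..
  qed
  then show ?thesis
    unfolding lower_op_def sum_distrib_right
    by (subst sum.swap) (simp only: sum_distrib_left mult.assoc)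
qed

text \<open>If the next layer were smaller, raising would kill some nonzero \<open>v\<close>
  supported on the layer \<open>w\<close>. The norm identity then reads
  \<open>|F v|^2 + (n * k - 2 * w) * |v|^2 = 0\<close>, impossible with a positive factor.\<close>

lemma card_subsets_of_sum_mono:
  assumes "2 * w < n * k"
  shows "card (subsets_of_sum (Suc n) k w) \<le> card (subsets_of_sum (Suc n) k (Suc w))"
proof (rule ccontr)
  let ?A = "subsets_of_sum (Suc n) k w" and ?B = "subsets_of_sum (Suc n) k (Suc w)"
  assume "\<not> ?thesis"
  then have "card ?B < card ?A" by simp
  from underdetermined_system[OF finite_subsets_of_sum finite_subsets_of_sum this,
      of "\<lambda>T S. \<Sum>i<n. ladder_coeff n i * of_bool (can_down i T \<and> down i T = S)"]
  obtain v :: "nat set \<Rightarrow> real" where v1: "\<exists>S\<in>?A. v S \<noteq> 0"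
    and v2: "\<forall>S. S \<notin> ?A \<longrightarrow> v S = 0"
    and ker: "\<forall>T\<in>?B.
      (\<Sum>S\<in>?A. (\<Sum>i<n. ladder_coeff n i * of_bool (can_down i T \<and> down i T = S)) * v S) = 0"
    by (elim exE conjE)
  note v = v1 v2[rule_format]
  have "raise_op n v T = 0" if "T \<in> ?B" for T
    using bspec[OF ker that] by (simp only: raise_op_eq_sum[where v = v, OF v(2)])
  \<comment> \<open>Raising sends the layer \<open>w\<close> only into the layer
    \<open>Suc w\<close>, so the equations over \<open>?B\<close> suffice.\<close>
  moreover have "raise_op n v T = 0" if "T \<notin> ?B" for T
    unfolding raise_op_def using that v(2) subsets_of_sum_down[of _ n T k w]
    by (intro sum.neutral) auto
  ultimately have "raise_op n v T = 0" for T by blast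
  then have "(\<Sum>T\<in>Pow {..<Suc n}. (lower_op n v T)\<^sup>2) +
      (real n * k - 2 * real w) * (\<Sum>S\<in>?A. (v S)\<^sup>2) = 0"
    using raise_lower_norm[of n v] weighted_norm[where v = v, OF v(2)] by simp
  moreover have "(\<Sum>T\<in>Pow {..<Suc n}. (lower_op n v T)\<^sup>2) \<ge> 0" by (rule sum_nonneg) simp
  moreover have "2 * real w < real n * real k"
    using of_nat_less_iff[of "2 * w" "n * k", where 'a = real] assms by simp
  ultimately show False
    using supported_sum_squares_pos[OF finite_subsets_of_sum v(1)]
      mult_pos_pos[of "real n * k - 2 * real w" "\<Sum>S\<in>?A. (v S)\<^sup>2"] by linarith
qed

text \<open>The dual argument: if lowering killed a nonzero \<open>v\<close>, then
  \<open>|E v|^2\<close> would be a negative multiple of \<open>|v|^2\<close>.\<close>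

lemma card_subsets_of_sum_antimono:
  assumes "2 * Suc w > n * k"
  shows "card (subsets_of_sum (Suc n) k (Suc w)) \<le> card (subsets_of_sum (Suc n) k w)"
proof (rule ccontr)
  let ?A = "subsets_of_sum (Suc n) k (Suc w)" and ?B = "subsets_of_sum (Suc n) k w"
  assume "\<not> ?thesis"
  then have "card ?B < card ?A" by simp
  from underdetermined_system[OF finite_subsets_of_sum finite_subsets_of_sum this,
      of "\<lambda>T S. \<Sum>i<n. ladder_coeff n i * of_bool (can_up i T \<and> up i T = S)"]
  obtain v :: "nat set \<Rightarrow> real" where v1: "\<exists>S\<in>?A. v S \<noteq> 0"
    and v2: "\<forall>S. S \<notin> ?A \<longrightarrow> v S = 0"
    and ker: "\<forall>T\<in>?B.
      (\<Sum>S\<in>?A. (\<Sum>i<n. ladder_coeff n i * of_bool (can_up i T \<and> up i T = S)) * v S) = 0"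
    by (elim exE conjE)
  note v = v1 v2[rule_format]
  have "lower_op n v T = 0" if "T \<in> ?B" for T
    using bspec[OF ker that] by (simp only: lower_op_eq_sum[where v = v, OF v(2)])
  moreover have "lower_op n v T = 0" if "T \<notin> ?B" for T
    unfolding lower_op_def using that v(2) subsets_of_sum_up[of _ n T k w]
    by (intro sum.neutral) auto
  ultimately have "lower_op n v T = 0" for T by blast
  then have "(\<Sum>T\<in>Pow {..<Suc n}. (raise_op n v T)\<^sup>2) =
      (real n * k - 2 * real (Suc w)) * (\<Sum>S\<in>?A. (v S)\<^sup>2)"
    using raise_lower_norm[of n v] weighted_norm[where v = v, OF v(2)] by simp
  moreover have "(\<Sum>T\<in>Pow {..<Suc n}. (raise_op n v T)\<^sup>2) \<ge> 0" by (rule sum_nonneg) simp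
  moreover have "real n * real k < 2 * real (Suc w)"
    using of_nat_less_iff[of "n * k" "2 * Suc w", where 'a = real] assms by simp
  ultimately show False
    using supported_sum_squares_pos[OF finite_subsets_of_sum v(1)]
      mult_neg_pos[of "real n * k - 2 * real (Suc w)" "\<Sum>S\<in>?A. (v S)\<^sup>2"] by linarith
qed

section \<open>Gaussian binomials and their quotients\<close>

text \<open>For \<open>k \<le> n\<close> this is the Gaussian binomial shifted by
  \<open>k choose 2\<close>, the sum of the smallest subset \<open>{0..k-1}\<close>.\<close>

definition subset_sum_poly :: "nat \<Rightarrow> nat \<Rightarrow> int poly" where
  "subset_sum_poly n k = (\<Sum>S\<in>{S. S \<subseteq> {..<n} \<and> card S = k}. monom 1 (\<Sum>S))"

lemma finite_subsets_of_card: "finite {S. S \<subseteq> {..<n::nat} \<and> card S = k}"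
  by (rule finite_subset[of _ "Pow {..<n}"]) auto

lemma coeff_subset_sum_poly: "coeff (subset_sum_poly n k) w = int (card (subsets_of_sum n k w))"
proof -
  have "coeff (subset_sum_poly n k) w =
      (\<Sum>S\<in>{S. S \<subseteq> {..<n} \<and> card S = k}. of_bool (\<Sum>S = w))"
    unfolding subset_sum_poly_def coeff_sum by (intro sum.cong) auto
  also have "\<dots> = (\<Sum>S\<in>subsets_of_sum n k w. 1)"
    by (rule sum.mono_neutral_cong_right[OF finite_subsets_of_card])
      (auto simp: subsets_of_sum_def)
  finally show ?thesis by simp
qed

lemma subset_sum_poly_0 [simp]: "subset_sum_poly n 0 = 1"
proof -
  have "{S. S \<subseteq> {..<n} \<and> card S = 0} = {{}}"
    by (auto dest: finite_subset)
  then show ?thesis by (simp add: subset_sum_poly_def)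
qed

lemma subset_sum_poly_eq_0:
  assumes "n < k"
  shows "subset_sum_poly n k = 0"
proof -
  have "card S \<noteq> k" if "S \<subseteq> {..<n}" for S
    using card_mono[OF finite_lessThan that] assms by simp
  then have "{S. S \<subseteq> {..<n} \<and> card S = k} = {}" by blast
  then show ?thesis by (simp only: subset_sum_poly_def sum.empty)
qed

text \<open>The q-Pascal rule: split according to whether \<open>n\<close> belongs to the
  subset.\<close>

lemma subset_sum_poly_Suc:
  "subset_sum_poly (Suc n) (Suc k) = subset_sum_poly n (Suc k) + monom 1 n * subset_sum_poly n k"
proof -
  let ?A = "{S. S \<subseteq> {..<n} \<and> card S = Suc k}" and ?B = "{S. S \<subseteq> {..<n} \<and> card S = k}"
  have fin: "finite S" if "S \<subseteq> {..<n}" for S using that by (rule finite_subset) simp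
  have "S \<in> ?A \<union> insert n ` ?B" if S: "S \<subseteq> {..<Suc n}" "card S = Suc k" for S
  proof (cases "n \<in> S")
    case True
    moreover have "S - {n} \<in> ?B"
      using S True unfolding lessThan_Suc by (simp add: subset_insert_iff)
    ultimately show ?thesis by (intro UnI2 image_eqI[of _ _ "S - {n}"]) auto
  next
    case False
    with S show ?thesis unfolding lessThan_Suc by (simp add: subset_insert)
  qed
  then have "{S. S \<subseteq> {..<Suc n} \<and> card S = Suc k} \<subseteq> ?A \<union> insert n ` ?B" by blast
  moreover have "?A \<union> insert n ` ?B \<subseteq> {S. S \<subseteq> {..<Suc n} \<and> card S = Suc k}"
  proof -
    have "card (insert n S) = Suc (card S)" if "S \<subseteq> {..<n}" for S
      using that fin[OF that] by (subst card_insert_disjoint) auto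
    then show ?thesis unfolding lessThan_Suc by auto
  qed
  ultimately have eq: "{S. S \<subseteq> {..<Suc n} \<and> card S = Suc k} = ?A \<union> insert n ` ?B"
    by (rule equalityI)
  have inj: "inj_on (insert n) ?B"
    by (rule inj_on_inverseI[where g = "\<lambda>S. S - {n}"]) auto
  have "subset_sum_poly (Suc n) (Suc k) = subset_sum_poly n (Suc k) +
      (\<Sum>S\<in>insert n ` ?B. monom 1 (\<Sum>S))"
    unfolding subset_sum_poly_def eq
    by (rule sum.union_disjoint) (auto simp: finite_subsets_of_card)
  also have "(\<Sum>S\<in>insert n ` ?B. monom 1 (\<Sum>S)) = (\<Sum>S\<in>?B. monom 1 n * monom (1::int) (\<Sum>S))"
    unfolding sum.reindex[OF inj] comp_def
  proof (rule sum.cong[OF refl])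
    fix S assume "S \<in> ?B"
    then have "\<Sum>(insert n S) = n + \<Sum>S" using fin by (subst sum.insert) auto
    then show "monom 1 (\<Sum>(insert n S)) = monom 1 n * monom (1::int) (\<Sum>S)"
      by (simp add: mult_monom)
  qed
  also have "\<dots> = monom 1 n * subset_sum_poly n k"
    by (simp add: subset_sum_poly_def sum_distrib_left)
  finally show ?thesis .
qed

lemma Suc_choose_2: "Suc k choose 2 = (k choose 2) + k"
  by (simp add: numeral_2_eq_2)

text \<open>Induction via the Pascal rule. Up to a common power of \<open>q\<close>, the step is
  \<open>(1 - q^l) + q^l * (1 - q^(k' + 1)) = 1 - q^(k' + l + 1)\<close>.\<close>

lemma subset_sum_poly_qfact:
  "subset_sum_poly (k + l) k * (qfact k * qfact l) = monom 1 (k choose 2) * qfact (k + l)"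
proof (induction "k + l" arbitrary: k l)
  case 0
  then show ?case by (simp add: numeral_2_eq_2)
next
  case (Suc n)
  show ?case
  proof (cases k)
    case 0
    then show ?thesis by (simp add: numeral_2_eq_2)
  next
    case (Suc k')
    have n: "n = k' + l" using Suc.hyps(2) Suc by simp
    let ?x = "monom (1::int)"
    have 1: "subset_sum_poly n (Suc k') * (qfact (Suc k') * qfact l) =
        ?x (Suc k' choose 2) * qfact n * (1 - ?x l)"
    \<comment> \<open>For \<open>l = 0\<close> both sides vanish: \<open>n < Suc k'\<close> and
      \<open>1 - ?x 0 = 0\<close>.\<close>
    proof (cases l)
      case 0
      then show ?thesis using n by (simp add: subset_sum_poly_eq_0)
    next
      case l: (Suc l')
      have "subset_sum_poly n (Suc k') * (qfact (Suc k') * qfact l') =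
          ?x (Suc k' choose 2) * qfact n"
        using Suc.hyps(1)[of "Suc k'" l'] n l by simp
      then have "subset_sum_poly n (Suc k') * (qfact (Suc k') * qfact l') * (1 - ?x l) =
          ?x (Suc k' choose 2) * qfact n * (1 - ?x l)"
        by simp
      then show ?thesis by (simp only: l qfact_Suc[of l'] mult.assoc)
    qed
    have 2: "subset_sum_poly n k' * (qfact k' * qfact l) = ?x (k' choose 2) * qfact n"
      using Suc.hyps(1)[of k' l] n by simp
    have "subset_sum_poly (Suc n) (Suc k') * (qfact (Suc k') * qfact l) =
        subset_sum_poly n (Suc k') * (qfact (Suc k') * qfact l) +
        ?x n * (1 - ?x (Suc k')) * (subset_sum_poly n k' * (qfact k' * qfact l))"
      unfolding subset_sum_poly_Suc by (simp add: qfact_Suc[of k'] algebra_simps)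
    also have "\<dots> = qfact n * (?x (Suc k' choose 2) * (1 - ?x l) +
        ?x (n + (k' choose 2)) * (1 - ?x (Suc k')))"
      unfolding 1 2 by (simp add: algebra_simps mult_monom)
    also have "?x (Suc k' choose 2) * (1 - ?x l) + ?x (n + (k' choose 2)) * (1 - ?x (Suc k')) =
        ?x (Suc k' choose 2) * (1 - ?x (Suc n))"
      by (simp add: algebra_simps mult_monom Suc_choose_2 n)
    finally show ?thesis
      using Suc n by (simp add: qfact_Suc mult_ac)
  qed
qed

text \<open>Here \<open>t\<close> is twice the centre of \<open>g\<close>; the recurrence
  \<open>rec\<close> is solved upward below the centre and downward above it.\<close>

lemma coeff_quotient_nonneg:
  fixes g r :: "int poly"
  assumes eq: "(1 - monom 1 m) * r = (1 - monom 1 1) * g" and "m > 0"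
    and nonneg: "\<And>w. coeff g w \<ge> 0"
    and incr: "\<And>w. 2 * w < t \<Longrightarrow> coeff g w \<le> coeff g (Suc w)"
    and decr: "\<And>w. 2 * Suc w > t \<Longrightarrow> coeff g (Suc w) \<le> coeff g w"
  shows "coeff r j \<ge> 0"
proof -
  have rec: "coeff r j - (if j < m then 0 else coeff r (j - m)) =
      coeff g j - (if j < 1 then 0 else coeff g (j - 1))" for j
    using arg_cong[OF eq, of "\<lambda>p. coeff p j"]
    by (cases "j < m"; cases "j = 0") (simp_all add: left_diff_distrib coeff_monom_mult)
  show ?thesis
  \<comment> \<open>For \<open>j > 0\<close> this says \<open>2 * (j - 1) < t\<close>, so
    \<open>g\<close> does not fall from \<open>j - 1\<close> to \<open>j\<close>. In the other case
    \<open>2 * (j + m) > t\<close>, so \<open>g\<close> does not rise from \<open>j + m - 1\<close>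
    to \<open>j + m\<close>.\<close>
  proof (cases "2 * j < t + 2")
    case True
    then show ?thesis
    proof (induction j rule: less_induct)
      case (less j)
      have "coeff g j - (if j < 1 then 0 else coeff g (j - 1)) \<ge> 0"
        using incr[of "j - 1"] less.prems nonneg[of j] by (cases j) auto
      moreover have "(if j < m then 0 else coeff r (j - m)) \<ge> 0"
        using less.IH[of "j - m"] less.prems \<open>m > 0\<close> by auto
      ultimately show ?case using rec[of j] by linarith
    qed
  next
    case False
    then show ?thesis
    \<comment> \<open>Downward induction on \<open>j\<close>, started by the zero coefficients above
      \<open>degree r\<close>.\<close>
    proof (induction "Suc (degree r) - j" arbitrary: j rule: less_induct)
      case less
      show ?case
      proof (cases "degree r < j")
        case True
        then show ?thesis by (simp add: coeff_eq_0)
      next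
        case False
        have "coeff r (j + m) \<ge> 0"
          using less.hyps[of "j + m"] less.prems False \<open>m > 0\<close> by simp
        moreover have "coeff g (j + m) \<le> coeff g (j + m - 1)"
          using decr[of "j + m - 1"] less.prems \<open>m > 0\<close> by simp
        ultimately show ?thesis using rec[of "j + m"] \<open>m > 0\<close> by simp
      qed
    qed
  qed
qed

section \<open>Transfer to the field of rational functions\<close>

lemma q_power: "q ^ i = to_fract (monom 1 i)"
proof (induction i)
  case 0
  show ?case by (simp flip: one_pCons add: monom_0)
next
  case (Suc i)
  have "[:0, 1:] * monom 1 i = (monom 1 (Suc i) :: int poly)" by (simp add: monom_Suc)
  with Suc show ?case by (simp add: q_def flip: to_fract_mult)
qed

lemma one_minus_q_power: "1 - q ^ i = to_fract (1 - monom 1 i)"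
  by (simp add: q_power)

lemma to_fract_prod: "to_fract (\<Prod>x\<in>A. f x) = (\<Prod>x\<in>A. to_fract (f x))"
  by (induction A rule: infinite_finite_induct) simp_all

lemma prod_one_minus_q_power: "(\<Prod>i=1..n. 1 - q ^ i) = to_fract (qfact n)"
  unfolding qfact_def to_fract_prod one_minus_q_power ..

lemma qbinomial_eq: "k \<le> n \<Longrightarrow> qbinomial n k = to_fract (qfact n) / to_fract (qfact k * qfact (n - k))"
  by (simp only: qbinomial_def prod_one_minus_q_power to_fract_mult if_True)

lemma quotient_qbinomial_eq:
  assumes "k \<le> n" "c \<noteq> 0" "b * qfact n = c * (qfact k * qfact (n - k)) * r"
  shows "to_fract b / to_fract c * qbinomial n k = to_fract r"
proof -
  have "to_fract b * to_fract (qfact n) =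
      to_fract c * to_fract (qfact k * qfact (n - k)) * to_fract r"
    unfolding to_fract_mult[symmetric] assms(3) ..
  moreover have "to_fract c \<noteq> 0" "to_fract (qfact k * qfact (n - k)) \<noteq> 0"
    using assms(2) by (simp_all add: qfact_nonzero del: to_fract_mult)
  moreover have "x / y * (u / v) = w" if "x * u = y * v * w" "y \<noteq> 0" "v \<noteq> 0" for x y u v w :: qfun
    using that by (simp add: field_simps)
  ultimately show ?thesis
    unfolding qbinomial_eq[OF assms(1)] by blast
qed

lemma is_nonneg_polynomial_quotient:
  assumes "k \<le> n" "n > 0" "m > 0"
    and carry: "\<And>d. d dvd m \<Longrightarrow> d > 1 \<Longrightarrow> n mod d < k mod d"
  shows "is_nonneg_polynomial ((1 - q) / (1 - q ^ m) * qbinomial n k)"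
proof -
  have "(1 - monom 1 m) * (qfact k * qfact (n - k)) dvd (1 - monom 1 1) * (qfact n :: int poly)"
    using qfact_dvd[of "{m}" k n] assms by simp
  then obtain r where r: "(1 - monom 1 1) * qfact n =
      (1 - monom 1 m) * (qfact k * qfact (n - k)) * (r :: int poly)"
    by (elim dvdE)
  have "(1 - q) / (1 - q ^ m) * qbinomial n k = to_fract r"
    using quotient_qbinomial_eq[OF assms(1) one_minus_monom_nonzero[OF \<open>m > 0\<close>] r]
    by (simp only: one_minus_q_power[symmetric] power_one_right)
  moreover have "coeff r i \<ge> 0" for i
  proof -
    let ?g = "subset_sum_poly n k" and ?x = "monom (1::int) (k choose 2)"
    have g: "?g * (qfact k * qfact (n - k)) = ?x * qfact n"
      using subset_sum_poly_qfact[of k "n - k"] \<open>k \<le> n\<close> by simp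
    \<comment> \<open>Multiplying by \<open>?x\<close> brings in the subset-sum polynomial; the
      nonzero \<open>qfact\<close> factors are then cancelled.\<close>
    have "(1 - monom 1 m) * (?x * r) * (qfact k * qfact (n - k)) =
        ?x * ((1 - monom 1 m) * (qfact k * qfact (n - k)) * r)"
      by (simp only: mult_ac)
    also have "\<dots> = (1 - monom 1 1) * (?x * qfact n)"
      unfolding r[symmetric] by (simp only: mult_ac)
    also have "\<dots> = (1 - monom 1 1) * ?g * (qfact k * qfact (n - k))"
      unfolding g[symmetric] by (simp only: mult.assoc)
    finally have eq: "(1 - monom 1 m) * (?x * r) = (1 - monom 1 1) * ?g"
      using qfact_nonzero[where 'a = int] by (simp only: mult_cancel_right mult_eq_0_iff) blast
    obtain n' where n': "n = Suc n'" using \<open>n > 0\<close> gr0_conv_Suc by blast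
    \<comment> \<open>Sums of \<open>k\<close>-subsets of \<open>{0..n'}\<close> are centred at
      \<open>n' * k / 2\<close>, hence the choice of \<open>t\<close>. The index shift undoes the
      factor \<open>?x\<close>.\<close>
    have "coeff (?x * r) (i + (k choose 2)) \<ge> 0"
    proof (rule coeff_quotient_nonneg[OF eq \<open>m > 0\<close>, where t = "n' * k"])
      show "coeff ?g w \<le> coeff ?g (Suc w)" if "2 * w < n' * k" for w
        using card_subsets_of_sum_mono[OF that] by (simp add: coeff_subset_sum_poly n')
      show "coeff ?g (Suc w) \<le> coeff ?g w" if "2 * Suc w > n' * k" for w
        using card_subsets_of_sum_antimono[OF that] by (simp add: coeff_subset_sum_poly n')
    qed (simp add: coeff_subset_sum_poly)
    then show ?thesis by (simp add: coeff_monom_mult)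
  qed
  ultimately show ?thesis unfolding is_nonneg_polynomial_def by blast
qed

lemma is_polynomial_quotient2:
  assumes "k \<le> n" "m > 0" "m' > 0" "m \<noteq> m'" "coprime m m'"
    and "\<And>d. d dvd m \<Longrightarrow> d > 1 \<Longrightarrow> n mod d < k mod d"
    and "\<And>d. d dvd m' \<Longrightarrow> d > 1 \<Longrightarrow> n mod d < k mod d"
  shows "is_polynomial ((1 - q)\<^sup>2 / ((1 - q ^ m) * (1 - q ^ m')) * qbinomial n k)"
proof -
  have "(\<Prod>m\<in>{m, m'}. 1 - monom 1 m) * (qfact k * qfact (n - k)) dvd
      (\<Prod>m\<in>{m, m'}. 1 - monom 1 1) * (qfact n :: int poly)"
    by (rule qfact_dvd) (use assms in \<open>auto simp: coprime_commute\<close>)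
  then have "(1 - monom 1 m) * (1 - monom 1 m') * (qfact k * qfact (n - k)) dvd
      (1 - monom 1 1)\<^sup>2 * (qfact n :: int poly)"
    using \<open>m \<noteq> m'\<close> by (simp add: power2_eq_square)
  then obtain r where r: "(1 - monom 1 1)\<^sup>2 * qfact n =
      (1 - monom 1 m) * (1 - monom 1 m') * (qfact k * qfact (n - k)) * (r :: int poly)"
    by (elim dvdE)
  have "(1 - monom 1 m) * (1 - monom 1 m') \<noteq> (0 :: int poly)"
    using assms by (simp add: monom_eq_1_iff)
  from quotient_qbinomial_eq[OF assms(1) this r]
  have "(1 - q)\<^sup>2 / ((1 - q ^ m) * (1 - q ^ m')) * qbinomial n k = to_fract r"
    by (simp only: to_fract_mult power2_eq_square one_minus_q_power[symmetric] power_one_right)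
  then show ?thesis unfolding is_polynomial_def by blast
qed

text \<open>Modulo \<open>d\<close> we have \<open>N \<equiv> s\<close> and \<open>a k \<equiv> b\<close>, so \<open>r = k mod d \<le> N mod d\<close> would force \<open>r \<le> s\<close> and
  \<open>d\<close> to divide \<open>a r - b\<close>; but \<open>d\<close> is coprime to \<open>A\<close>.\<close>

lemma mod_less_mod_criterion:
  fixes A n d s a b N k :: nat
  assumes d: "d dvd A * n - 1" "d > 1" and pos: "A > 0" "n > 0"
    and N: "N = s * (A * n)" and k: "a * k = b * (A * n)"
    and small: "\<forall>r\<in>set [0..<Suc s]. int a * int r - int b dvd int A ^ 3 \<or>
      r > 0 \<and> int a * int r - int b dvd int s"
  shows "N mod d < k mod d"
proof (rule ccontr)
  assume contra: "\<not> ?thesis"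
  define r where "r = k mod d"
  obtain m where m: "A * n = Suc m" using pos by (metis gr0_conv_Suc nat_0_less_mult_iff)
  have dm: "d dvd m" using d m by simp
  have Nmod: "N mod d = s mod d"
    using mod_mult_self2[of s d] dm by (auto simp: N m mult.left_commute elim!: dvdE)
  have "r \<le> N mod d" using contra by (simp add: r_def)
  also have "\<dots> \<le> s" by (simp add: Nmod)
  finally have "r \<in> set [0..<Suc s]" by auto
  have "int a * int k = int b * (1 + int m)"
    using k unfolding m by (metis of_nat_Suc of_nat_mult)
  moreover have "int k = int d * int (k div d) + int r"
    unfolding r_def by (metis mult_div_mod_eq of_nat_add of_nat_mult)
  ultimately have "int a * int r - int b = int b * int m - int d * (int a * int (k div d))"
    by (simp add: algebra_simps)
  then have dvd: "int d dvd int a * int r - int b"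
    using dm by simp
  \<comment> \<open>Divisors of a power of \<open>A\<close> are coprime to \<open>A * n - 1\<close>;
    the cube admits the value 8, which occurs for \<open>A = 30\<close> and
    \<open>A = 66\<close>.\<close>
  have "\<not> int a * int r - int b dvd int A ^ 3"
  proof
    assume "int a * int r - int b dvd int A ^ 3"
    with dvd have "int d dvd int (A ^ 3)" by (metis dvd_trans of_nat_power)
    then have "d dvd A ^ 3" by (simp only: int_dvd_int_iff)
    moreover have "coprime (A ^ 3) m"
    proof -
      have "coprime (A * n) m" unfolding m by simp
      then show ?thesis by simp
    qed
    ultimately have "d dvd 1" using dm coprime_common_divisor by blast
    with d show False by simp
  qed
  \<comment> \<open>In the remaining alternative \<open>d\<close> divides \<open>s\<close>, so
    \<open>N mod d = 0\<close>, against \<open>0 < r \<le> N mod d\<close>.\<close>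
  with small \<open>r \<in> set [0..<Suc s]\<close> have "r > 0" "int a * int r - int b dvd int s" by blast+
  with dvd have "d dvd s" by (metis dvd_trans int_dvd_int_iff)
  with Nmod \<open>r \<le> N mod d\<close> \<open>r > 0\<close> show False by simp
qed

theorem theorem3p1:
  fixes n :: nat
  assumes "n > 0"
  shows "is_nonneg_polynomial ((1 - q) / (1 - q ^ (6 * n - 1)) * qbinomial (12 * n) (3 * n)) \<and>
    is_nonneg_polynomial ((1 - q) / (1 - q ^ (6 * n - 1)) * qbinomial (12 * n) (4 * n)) \<and>
    is_nonneg_polynomial ((1 - q) / (1 - q ^ (30 * n - 1)) * qbinomial (60 * n) (6 * n)) \<and>
    is_nonneg_polynomial ((1 - q) / (1 - q ^ (30 * n - 1)) * qbinomial (120 * n) (40 * n)) \<and>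
    is_nonneg_polynomial ((1 - q) / (1 - q ^ (30 * n - 1)) * qbinomial (120 * n) (45 * n)) \<and>
    is_nonneg_polynomial ((1 - q) / (1 - q ^ (66 * n - 1)) * qbinomial (330 * n) (88 * n)) \<and>
    is_polynomial ((1 - q)\<^sup>2 / ((1 - q ^ (10 * n - 1)) * (1 - q ^ (15 * n - 1)))
      * qbinomial (30 * n) (5 * n))"
proof (intro conjI)
  show "is_nonneg_polynomial ((1 - q) / (1 - q ^ (6 * n - 1)) * qbinomial (12 * n) (3 * n))"
  proof (rule is_nonneg_polynomial_quotient)
    show "12 * n mod d < 3 * n mod d" if "d dvd 6 * n - 1" "d > 1" for d
      \<comment> \<open>Here \<open>s\<close> is \<open>12 n / (6 n)\<close> and
        \<open>b / a\<close> is \<open>3 n / (6 n)\<close> in lowest terms; the other cases follow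
        the same pattern. Unfolding \<open>upt_rec\<close> checks each
        \<open>r \<le> s\<close>.\<close>
      by (rule mod_less_mod_criterion[OF that, where s = 2 and a = 2 and b = 1])
        (use assms in \<open>simp_all add: upt_rec\<close>)
  qed (use assms in auto)
  show "is_nonneg_polynomial ((1 - q) / (1 - q ^ (6 * n - 1)) * qbinomial (12 * n) (4 * n))"
  proof (rule is_nonneg_polynomial_quotient)
    show "12 * n mod d < 4 * n mod d" if "d dvd 6 * n - 1" "d > 1" for d
      by (rule mod_less_mod_criterion[OF that, where s = 2 and a = 3 and b = 2])
        (use assms in \<open>simp_all add: upt_rec\<close>)
  qed (use assms in auto)
  show "is_nonneg_polynomial ((1 - q) / (1 - q ^ (30 * n - 1)) * qbinomial (60 * n) (6 * n))"
  proof (rule is_nonneg_polynomial_quotient)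
    show "60 * n mod d < 6 * n mod d" if "d dvd 30 * n - 1" "d > 1" for d
      by (rule mod_less_mod_criterion[OF that, where s = 2 and a = 5 and b = 1])
        (use assms in \<open>simp_all add: upt_rec\<close>)
  qed (use assms in auto)
  show "is_nonneg_polynomial ((1 - q) / (1 - q ^ (30 * n - 1)) * qbinomial (120 * n) (40 * n))"
  proof (rule is_nonneg_polynomial_quotient)
    show "120 * n mod d < 40 * n mod d" if "d dvd 30 * n - 1" "d > 1" for d
      by (rule mod_less_mod_criterion[OF that, where s = 4 and a = 3 and b = 4])
        (use assms in \<open>simp_all add: upt_rec\<close>)
  qed (use assms in auto)
  show "is_nonneg_polynomial ((1 - q) / (1 - q ^ (30 * n - 1)) * qbinomial (120 * n) (45 * n))"
  proof (rule is_nonneg_polynomial_quotient)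
    show "120 * n mod d < 45 * n mod d" if "d dvd 30 * n - 1" "d > 1" for d
      by (rule mod_less_mod_criterion[OF that, where s = 4 and a = 2 and b = 3])
        (use assms in \<open>simp_all add: upt_rec\<close>)
  qed (use assms in auto)
  show "is_nonneg_polynomial ((1 - q) / (1 - q ^ (66 * n - 1)) * qbinomial (330 * n) (88 * n))"
  proof (rule is_nonneg_polynomial_quotient)
    show "330 * n mod d < 88 * n mod d" if "d dvd 66 * n - 1" "d > 1" for d
      \<comment> \<open>At \<open>r = 3\<close> the value \<open>a * r - b = 5\<close> does not
        divide a power of 66, but it divides \<open>s\<close>.\<close>
      by (rule mod_less_mod_criterion[OF that, where s = 5 and a = 3 and b = 4])
        (use assms in \<open>simp_all add: upt_rec\<close>)
  qed (use assms in auto)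
  show "is_polynomial ((1 - q)\<^sup>2 / ((1 - q ^ (10 * n - 1)) * (1 - q ^ (15 * n - 1)))
      * qbinomial (30 * n) (5 * n))"
  proof (rule is_polynomial_quotient2)
    show "30 * n mod d < 5 * n mod d" if "d dvd 10 * n - 1" "d > 1" for d
      \<comment> \<open>The exceptional value is 3 at \<open>r = 2\<close>, which divides
        \<open>s\<close>; for \<open>15 * n - 1\<close> below it is 2 at
        \<open>r = 1\<close>.\<close>
      by (rule mod_less_mod_criterion[OF that, where s = 3 and a = 2 and b = 1])
        (use assms in \<open>simp_all add: upt_rec\<close>)
    show "30 * n mod d < 5 * n mod d" if "d dvd 15 * n - 1" "d > 1" for d
      by (rule mod_less_mod_criterion[OF that, where s = 2 and a = 3 and b = 1])
        (use assms in \<open>simp_all add: upt_rec\<close>)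
    show "coprime (10 * n - 1) (15 * n - 1)"
    proof (rule coprimeI)
      fix d assume "d dvd 10 * n - 1" "d dvd 15 * n - 1"
      then have "d dvd 2 * (15 * n - 1) - 3 * (10 * n - 1)"
        by (intro dvd_diff_nat[OF dvd_mult dvd_mult])
      moreover have "2 * (15 * n - 1) - 3 * (10 * n - 1) = 1" using assms by simp
      ultimately show "is_unit d" by (simp only:)
    qed
  qed (use assms in auto)
qed

end
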